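(* Let $d,n,g,r,k,l\in\mathbb N$ and let $\Psi:\mathcal M(\mathbb C)_{kdg}\to\mathcal M(\mathbb C)_{lnr}$ be a quantum superchannel between multimeters that admits an ancilla-free realization (neither quantum nor classical ancilla). The following assertions are equivalent: (1) $\Psi$ is triviality-preserving. (2) $\Psi$ admits an ancilla-free realization $(\Lambda,\nu)$ for which there exists a conditional probability distribution $\pi=(\pi_{\cdot|y})_{y\in[r]}$ on $[g]$ such that $\Lambda^*_{x|y}(\mathbb 1)=\pi_{x|y}\mathbb 1$ for all $x\in[g]$ and $y\in[r]$. (3) $\Psi$ admits an ancilla-free realization $(\Lambda,\nu)$ for which there exist a conditional probability distribution $\pi=(\pi_{\cdot|y})_{y\in[r]}$ on $[g]$ and a family of $g\cdot r$ quantum channels $\{\Phi_{x,y}\}_{x\in[g],y\in[r]}\subset\mathfrak C(\mathbb C^n,\mathbb C^d)$ such that $\Lambda_{x|y}=\pi_{x|y}\Phi_{x,y}$ for all $x\in[g]$ and $y\in[r]$.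
   Context: Notation: $[m]=\{1,\dots,m\}$; $\mathcal M(\mathbb C)_m$ is the set of complex $m\times m$ matrices. $\mathfrak C(\mathbb C^n,\mathbb C^d)$ is the set of quantum channels (completely positive trace-preserving maps) $\mathcal M(\mathbb C)_n\to\mathcal M(\mathbb C)_d$. $\mathfrak M(k,\mathbb C^d)$ is the set of $k$-outcome POVMs on $\mathbb C^d$. $\mathfrak I(m,\mathbb C^n,\mathbb C^d)$ is the set of $m$-outcome instruments: tuples $(\Lambda_j)_{j\in[m]}$ of completely positive (CP) maps $\mathcal M(\mathbb C)_n\to\mathcal M(\mathbb C)_d$ such that $\sum_j\Lambda_j$ is a channel. $\Lambda^*$ is the dual map: $\mathrm{Tr}[\Lambda^*(A)X]=\mathrm{Tr}[A\Lambda(X)]$. A conditional probability distribution $(p_{\cdot|y})_{y}$ on $[m]$ is a family of probability distributions on $[m]$ indexed by $y$. A multimeter is a collection $M=\{M_{\cdot|x}\}_{x\in[g]}\subset\mathfrak M(k,\mathbb C^d)$. Its multimeter channel $\Phi_M:\mathcal M(\mathbb C)_{dg}\to\mathcal M(\mathbb C)_k$ is $\Phi_M(\sigma)=\sum_{x,a}\mathrm{Tr}[(M_{a|x}\otimes|x\rangle\langle x|)\sigma]|a\rangle\langle a|$, with Choi matrix $J_{\Phi_M}=\sum_{x,a}|a\rangle\langle a|\otimes M_{a|x}^T\otimes|x\rangle\langle x|\in\mathcal M(\mathbb C)_{kdg}$ (fixed orthonormal bases). A quantum superchannel (transformation) between multimeters is a CP map $\Psi:\mathcal M(\mathbb C)_{kdg}\to\mathcal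 M(\mathbb C)_{lnr}$ which maps the Choi matrix $J_{\Phi_M}$ of every multimeter $M=\{M_{\cdot|x}\}_{x\in[g]}\subset\mathfrak M(k,\mathbb C^d)$ to the Choi matrix $J_{\Phi_N}$ of some multimeter $N=\{N_{\cdot|y}\}_{y\in[r]}\subset\mathfrak M(l,\mathbb C^n)$. An ancilla-free realization of $\Psi$ is a pair $(\Lambda,\nu)$ of a set of instruments $\Lambda=\{\Lambda_{\cdot|y}\}_{y\in[r]}\subset\mathfrak I(g,\mathbb C^n,\mathbb C^d)$ and a conditional probability distribution $\nu=(\nu_{\cdot|a,x,y})_{a\in[k],x\in[g],y\in[r]}$ on $[l]$ such that for every multimeter $M\subset\mathfrak M(k,\mathbb C^d)$, $\Psi(J_{\Phi_M})=J_{\Phi_N}$ with $N_{b|y}=\sum_{x=1}^g\sum_{a=1}^k\nu_{b|a,x,y}\Lambda^*_{x|y}(M_{a|x})$. A POVM is trivial if all its effects are multiples of the identity ($M_a=p_a\mathbb 1$ for a probability distribution $p$). $\Psi$ is triviality-preserving if whenever $M$ consists only of trivial POVMs, the multimeter $N$ with $\Psi(J_{\Phi_M})=J_{\Phi_N}$ consists only of trivial POVMs. *)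

theory Defs
  imports "HOL-Analysis.Analysis"
begin

text \<open>
  The space of complex matrices of size \<open>d\<close> is \<open>complex^'d^'d\<close> with \<open>d = CARD('d)\<close>. The standard
  basis, indexed by \<open>'d\<close>, is the fixed orthonormal basis, and tensor products are indexed by
  product types.
\<close>

definition matrix_scale :: "complex \<Rightarrow> complex^'n^'m \<Rightarrow> complex^'n^'m" where
  "matrix_scale c A = (\<chi> i j. c * A $ i $ j)"

definition matrix_unit :: "'d::finite \<Rightarrow> 'd \<Rightarrow> complex^'d^'d" where
  "matrix_unit i j = (\<chi> p q. if p = i \<and> q = j then 1 else 0)"

definition tensor ::
    "complex^'a^'a \<Rightarrow> complex^'b^'b \<Rightarrow> complex^('a::finite \<times> 'b::finite)^('a \<times> 'b)" where
  "tensor A B = (\<chi> p q. A $ fst p $ fst q * B $ snd p $ snd q)"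

definition sesq_form :: "complex^'d::finite \<Rightarrow> complex^'d^'d \<Rightarrow> complex^'d \<Rightarrow> complex" where
  "sesq_form u A v = (\<Sum>p\<in>UNIV. \<Sum>q\<in>UNIV. cnj (u $ p) * A $ p $ q * v $ q)"

text \<open>
  Over the complex numbers this condition (a real and nonnegative quadratic form) already forces
  \<open>A\<close> to be Hermitian.
\<close>

definition psd :: "complex^'d::finite^'d \<Rightarrow> bool" where
  "psd A \<longleftrightarrow> (\<forall>v. sesq_form v A v \<in> \<real>\<^sub>\<ge>\<^sub>0)"

text \<open>
  Complete positivity quantifies over the size \<open>m\<close> of the auxiliary system, so an element of
  the tensor product of the \<open>m\<close> by \<open>m\<close> matrices with \<open>complex^'d^'d\<close> is written as an array of
  blocks \<open>A i j\<close> with \<open>i, j < m\<close>, and a vector of the corresponding space as \<open>v i\<close> with \<open>i < m\<close>.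
  The map \<open>\<Lambda>\<close> tensored with the identity acts on each block.
\<close>

definition psd_block :: "nat \<Rightarrow> (nat \<Rightarrow> nat \<Rightarrow> complex^'d::finite^'d) \<Rightarrow> bool" where
  "psd_block m A \<longleftrightarrow> (\<forall>v. (\<Sum>i<m. \<Sum>j<m. sesq_form (v i) (A i j) (v j)) \<in> \<real>\<^sub>\<ge>\<^sub>0)"

definition completely_positive :: "(complex^'n::finite^'n \<Rightarrow> complex^'d::finite^'d) \<Rightarrow> bool" where
  "completely_positive \<Lambda> \<longleftrightarrow>
     Vector_Spaces.linear matrix_scale matrix_scale \<Lambda> \<and>
     (\<forall>m A. psd_block m A \<longrightarrow> psd_block m (\<lambda>i j. \<Lambda> (A i j)))"

definition trace_preserving :: "(complex^'n::finite^'n \<Rightarrow> complex^'d::finite^'d) \<Rightarrow> bool" where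
  "trace_preserving \<Lambda> \<longleftrightarrow> (\<forall>X. trace (\<Lambda> X) = trace X)"

definition quantum_channel :: "(complex^'n::finite^'n \<Rightarrow> complex^'d::finite^'d) \<Rightarrow> bool" where
  "quantum_channel \<Lambda> \<longleftrightarrow> completely_positive \<Lambda> \<and> trace_preserving \<Lambda>"

definition instrument ::
    "('m::finite \<Rightarrow> complex^'n::finite^'n \<Rightarrow> complex^'d::finite^'d) \<Rightarrow> bool" where
  "instrument \<Lambda> \<longleftrightarrow>
     (\<forall>j. completely_positive (\<Lambda> j)) \<and> quantum_channel (\<lambda>X. \<Sum>j\<in>UNIV. \<Lambda> j X)"

definition dual_map ::
    "(complex^'n::finite^'n \<Rightarrow> complex^'d::finite^'d) \<Rightarrow> complex^'d^'d \<Rightarrow> complex^'n^'n" where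
  "dual_map \<Lambda> A = (THE B. \<forall>X. trace (B ** X) = trace (A ** \<Lambda> X))"

definition prob_dist :: "('a::finite \<Rightarrow> real) \<Rightarrow> bool" where
  "prob_dist p \<longleftrightarrow> (\<forall>a. 0 \<le> p a) \<and> (\<Sum>a\<in>UNIV. p a) = 1"

definition povm :: "('k::finite \<Rightarrow> complex^'d::finite^'d) \<Rightarrow> bool" where
  "povm E \<longleftrightarrow> (\<forall>a. psd (E a)) \<and> (\<Sum>a\<in>UNIV. E a) = mat 1"

definition trivial_povm :: "('k::finite \<Rightarrow> complex^'d::finite^'d) \<Rightarrow> bool" where
  "trivial_povm E \<longleftrightarrow> povm E \<and> (\<exists>p. prob_dist p \<and> (\<forall>a. E a = p a *\<^sub>R mat 1))"

text \<open>
  For multimeters, instruments and conditional distributions the index of the whole object comes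
  first: \<open>M x a\<close> is the effect of outcome \<open>a\<close> in the POVM with setting \<open>x\<close>.
\<close>

definition multimeter :: "('g::finite \<Rightarrow> 'k::finite \<Rightarrow> complex^'d::finite^'d) \<Rightarrow> bool" where
  "multimeter M \<longleftrightarrow> (\<forall>x. povm (M x))"

definition multimeter_channel ::
    "('g::finite \<Rightarrow> 'k::finite \<Rightarrow> complex^'d::finite^'d) \<Rightarrow>
     complex^('d \<times> 'g)^('d \<times> 'g) \<Rightarrow> complex^'k^'k" where
  "multimeter_channel M \<sigma> =
     (\<Sum>x\<in>UNIV. \<Sum>a\<in>UNIV.
        matrix_scale (trace (tensor (M x a) (matrix_unit x x) ** \<sigma>)) (matrix_unit a a))"

text \<open>The output system of the map is the first tensor factor of its Choi matrix.\<close>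

definition choi_matrix ::
    "(complex^'n::finite^'n \<Rightarrow> complex^'d::finite^'d) \<Rightarrow> complex^('d \<times> 'n)^('d \<times> 'n)" where
  "choi_matrix \<Phi> = (\<Sum>i\<in>UNIV. \<Sum>j\<in>UNIV. tensor (\<Phi> (matrix_unit i j)) (matrix_unit i j))"

definition multimeter_choi ::
    "('g::finite \<Rightarrow> 'k::finite \<Rightarrow> complex^'d::finite^'d) \<Rightarrow>
     complex^('k \<times> 'd \<times> 'g)^('k \<times> 'd \<times> 'g)" where
  "multimeter_choi M = choi_matrix (multimeter_channel M)"

definition multimeter_superchannel ::
    "(complex^('k::finite \<times> 'd::finite \<times> 'g::finite)^('k \<times> 'd \<times> 'g) \<Rightarrow>
      complex^('l::finite \<times> 'n::finite \<times> 'r::finite)^('l \<times> 'n \<times> 'r)) \<Rightarrow> bool" where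
  "multimeter_superchannel \<Psi> \<longleftrightarrow>
     completely_positive \<Psi> \<and>
     (\<forall>M :: 'g \<Rightarrow> 'k \<Rightarrow> complex^'d^'d. multimeter M \<longrightarrow>
        (\<exists>N :: 'r \<Rightarrow> 'l \<Rightarrow> complex^'n^'n. multimeter N \<and>
           \<Psi> (multimeter_choi M) = multimeter_choi N))"

definition ancilla_free_realization ::
    "(complex^('k::finite \<times> 'd::finite \<times> 'g::finite)^('k \<times> 'd \<times> 'g) \<Rightarrow>
      complex^('l::finite \<times> 'n::finite \<times> 'r::finite)^('l \<times> 'n \<times> 'r)) \<Rightarrow>
     ('r \<Rightarrow> 'g \<Rightarrow> complex^'n^'n \<Rightarrow> complex^'d^'d) \<Rightarrow>
     ('k \<Rightarrow> 'g \<Rightarrow> 'r \<Rightarrow> 'l \<Rightarrow> real) \<Rightarrow> bool" where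
  "ancilla_free_realization \<Psi> \<Lambda> \<nu> \<longleftrightarrow>
     (\<forall>y. instrument (\<Lambda> y)) \<and>
     (\<forall>a x y. prob_dist (\<nu> a x y)) \<and>
     (\<forall>M :: 'g \<Rightarrow> 'k \<Rightarrow> complex^'d^'d. multimeter M \<longrightarrow>
        \<Psi> (multimeter_choi M) =
          multimeter_choi (\<lambda>y b. \<Sum>x\<in>UNIV. \<Sum>a\<in>UNIV. \<nu> a x y b *\<^sub>R dual_map (\<Lambda> y x) (M x a)))"

text \<open>
  A multimeter is determined by its Choi matrix (lemma \<open>multimeter_choi_inject\<close> below), so \<open>N\<close>
  is unique here.
\<close>

definition triviality_preserving ::
    "(complex^('k::finite \<times> 'd::finite \<times> 'g::finite)^('k \<times> 'd \<times> 'g) \<Rightarrow>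
      complex^('l::finite \<times> 'n::finite \<times> 'r::finite)^('l \<times> 'n \<times> 'r)) \<Rightarrow> bool" where
  "triviality_preserving \<Psi> \<longleftrightarrow>
     (\<forall>M :: 'g \<Rightarrow> 'k \<Rightarrow> complex^'d^'d. \<forall>N :: 'r \<Rightarrow> 'l \<Rightarrow> complex^'n^'n.
        multimeter M \<longrightarrow> (\<forall>x. trivial_povm (M x)) \<longrightarrow>
        multimeter N \<longrightarrow> \<Psi> (multimeter_choi M) = multimeter_choi N \<longrightarrow>
        (\<forall>y. trivial_povm (N y)))"

subsection \<open>Adequacy of the definitions\<close>

lemma vector_space_matrix_scale: "vector_space matrix_scale"
  by unfold_locales (simp_all add: matrix_scale_def vec_eq_iff algebra_simps)

lemma matrix_scale_component: "matrix_scale c A $ i $ j = c * A $ i $ j"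
  by (simp add: matrix_scale_def)

lemma matrix_unit_component: "matrix_unit i j $ p $ q = (if p = i \<and> q = j then 1 else 0)"
  by (simp add: matrix_unit_def)

lemma tensor_component: "tensor A B $ (a, b) $ (c, e) = A $ a $ c * B $ b $ e"
  by (simp add: tensor_def)

lemmas matrix_components = matrix_scale_component matrix_unit_component tensor_component

lemma trace_matrix_unit_mult: "trace (B ** matrix_unit i j) = B $ j $ i"
proof -
  have "trace (B ** matrix_unit i j)
      = (\<Sum>p\<in>UNIV. \<Sum>q\<in>UNIV. if q = i then (if p = j then B $ p $ i else 0) else 0)"
    unfolding trace_def matrix_matrix_mult_def vec_lambda_beta matrix_components
    by (intro sum.cong refl) auto
  then show ?thesis by simp
qed

lemma matrix_unit_expansion:
  "X = (\<Sum>i\<in>UNIV. \<Sum>j\<in>UNIV. matrix_scale (X $ i $ j) (matrix_unit i j))"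
proof -
  have "(\<Sum>i\<in>UNIV. \<Sum>j\<in>UNIV. matrix_scale (X $ i $ j) (matrix_unit i j)) $ p $ q = X $ p $ q"
    for p q
  proof -
    have "(\<Sum>i\<in>UNIV. \<Sum>j\<in>UNIV. matrix_scale (X $ i $ j) (matrix_unit i j)) $ p $ q
       = (\<Sum>i\<in>UNIV. \<Sum>j\<in>UNIV. if j = q then (if i = p then X $ i $ j else 0) else 0)"
      unfolding sum_component matrix_components
      by (intro sum.cong refl) auto
    then show ?thesis by simp
  qed
  then show ?thesis by (simp add: vec_eq_iff)
qed

lemma dual_map_trace:
  fixes \<Lambda> :: "complex^'n::finite^'n \<Rightarrow> complex^'d::finite^'d"
  assumes "Vector_Spaces.linear matrix_scale matrix_scale \<Lambda>"
  shows "trace (dual_map \<Lambda> A ** X) = trace (A ** \<Lambda> X)"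
proof -
  interpret L: Vector_Spaces.linear matrix_scale matrix_scale \<Lambda> by fact
  define B :: "complex^'n^'n" where "B = (\<chi> i j. trace (A ** \<Lambda> (matrix_unit j i)))"
  have tr_sum: "trace (C ** (\<Sum>i\<in>S. f i)) = (\<Sum>i\<in>S. trace (C ** f i))"
    if "finite S" for C :: "complex^'m::finite^'m" and f and S :: "'n set"
    using that by (induction S) (simp_all add: matrix_add_ldistrib trace_def sum.distrib)
  have tr_scale: "trace (C ** matrix_scale c D) = c * trace (C ** D)"
    for C D :: "complex^'m::finite^'m" and c
    unfolding trace_def matrix_matrix_mult_def matrix_scale_def
    by (simp add: sum_distrib_left mult_ac)
  have 1: "trace (B ** X) = trace (A ** \<Lambda> X)" for X
  proof -
    have "trace (B ** X) = (\<Sum>i\<in>UNIV. \<Sum>j\<in>UNIV. X $ i $ j * B $ j $ i)"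
      by (subst matrix_unit_expansion[of X])
        (simp add: tr_sum tr_scale trace_matrix_unit_mult)
    also have "\<dots> = (\<Sum>i\<in>UNIV. \<Sum>j\<in>UNIV. X $ i $ j * trace (A ** \<Lambda> (matrix_unit i j)))"
      by (simp add: B_def)
    also have "\<dots> = trace (A ** \<Lambda> X)"
      by (subst (2) matrix_unit_expansion[of X])
        (simp add: L.sum L.scale tr_sum tr_scale)
    finally show ?thesis .
  qed
  have 2: "C = B" if "\<forall>X. trace (C ** X) = trace (A ** \<Lambda> X)" for C
  proof -
    have "C $ i $ j = B $ i $ j" for i j
      using that 1 by (metis trace_matrix_unit_mult)
    then show ?thesis by (simp add: vec_eq_iff)
  qed
  have "dual_map \<Lambda> A = B"
    unfolding dual_map_def using 1 2 by (intro the_equality) auto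
  then show ?thesis using 1 by simp
qed

lemma trace_tensor_unit:
  "trace (tensor B (matrix_unit x x) ** matrix_unit (i, s) (j, t)) =
     (if s = x \<and> t = x then B $ j $ i else 0)"
  by (auto simp: trace_matrix_unit_mult matrix_components)

lemma choi_matrix_component:
  "choi_matrix \<Phi> $ (a, i) $ (b, j) = \<Phi> (matrix_unit i j) $ a $ b"
proof -
  have "choi_matrix \<Phi> $ (a, i) $ (b, j) = (\<Sum>p\<in>UNIV. \<Sum>q\<in>UNIV.
      if q = j then (if p = i then \<Phi> (matrix_unit p q) $ a $ b else 0) else 0)"
    unfolding choi_matrix_def sum_component matrix_components
    by (intro sum.cong refl) auto
  then show ?thesis by simp
qed

lemma multimeter_choi_component:
  "multimeter_choi M $ (a, i, s) $ (b, j, t) = (if a = b \<and> s = t then M s a $ j $ i else 0)"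
proof -
  have "multimeter_choi M $ (a, i, s) $ (b, j, t) = (\<Sum>x\<in>UNIV. \<Sum>c\<in>UNIV.
      if c = a then (if x = s then (if a = b \<and> s = t then M x c $ j $ i else 0) else 0) else 0)"
    unfolding multimeter_choi_def choi_matrix_component multimeter_channel_def
      sum_component matrix_components trace_tensor_unit
    by (intro sum.cong refl) auto
  then show ?thesis by simp
qed

lemma multimeter_choi_eq:
  "multimeter_choi M = (\<Sum>x\<in>UNIV. \<Sum>a\<in>UNIV.
     tensor (matrix_unit a a) (tensor (transpose (M x a)) (matrix_unit x x)))"
proof -
  have "(\<Sum>x\<in>UNIV. \<Sum>a\<in>UNIV.
      tensor (matrix_unit a a) (tensor (transpose (M x a)) (matrix_unit x x)))
      $ (a, i, s) $ (b, j, t) = (if a = b \<and> s = t then M s a $ j $ i else 0)" for a i s b j t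
  proof -
    have "(\<Sum>x\<in>UNIV. \<Sum>a\<in>UNIV.
      tensor (matrix_unit a a) (tensor (transpose (M x a)) (matrix_unit x x)))
      $ (a, i, s) $ (b, j, t) = (\<Sum>x\<in>UNIV. \<Sum>c\<in>UNIV.
      if c = a then (if x = s then (if a = b \<and> s = t then M x c $ j $ i else 0) else 0) else 0)"
      unfolding sum_component matrix_components
      by (intro sum.cong refl) (auto simp: transpose_def)
    then show ?thesis by simp
  qed
  then show ?thesis by (auto simp: vec_eq_iff multimeter_choi_component)
qed

lemma multimeter_choi_inject: "multimeter_choi M = multimeter_choi N \<longleftrightarrow> M = N"
proof
  assume "multimeter_choi M = multimeter_choi N"
  then have "M x a $ j $ i = N x a $ j $ i" for x a i j
    using multimeter_choi_component[of M a i x a j x] multimeter_choi_component[of N a i x a j x]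
    by simp
  then show "M = N" by (simp add: fun_eq_iff vec_eq_iff)
qed simp

end

theory Submission
  imports Defs
begin

text \<open>
  Fix \<open>y\<close> and put \<open>E\<^sub>x = \<Lambda>\<^sup>*\<^sub>x(1)\<close>. Feeding deterministic trivial multimeters into \<open>\<Psi>\<close> and
  varying a single outcome shows that \<open>(\<nu>\<^sub>b\<^sub>a\<^sub>x - \<nu>\<^sub>b\<^sub>a'\<^sub>x) E\<^sub>x\<close> is a multiple of the identity. So
  either \<open>E\<^sub>x\<close> is itself a multiple of the identity, or \<open>\<nu>\<^sub>b\<^sub>a\<^sub>x\<close> does not depend on \<open>a\<close>; in the
  latter case \<open>\<Lambda>\<^sub>x\<close> enters the output only through \<open>E\<^sub>x\<close>. Let \<open>\<pi>\<^sub>x\<close> be a fixed diagonal entry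
  of \<open>E\<^sub>x\<close>. Replacing \<open>\<Lambda>\<^sub>x\<close> by \<open>\<pi>\<^sub>x \<Sum>\<^sub>z \<Lambda>\<^sub>z\<close> for the \<open>x\<close> of the second kind, and keeping \<open>\<nu>\<close>,
  does not change the output: the total contribution of these \<open>x\<close> is a multiple of the identity,
  hence determined by its diagonal entry.
\<close>

section \<open>Traces and dual maps\<close>

lemma trace_scaleR_mult: "trace ((c *\<^sub>R A) ** B) = c *\<^sub>R trace (A ** B)"
  for A B :: "complex^'d::finite^'d"
  by (simp add: trace_def matrix_matrix_mult_def scaleR_sum_right)

lemma trace_sum_mult: "trace (sum f S ** B) = (\<Sum>i\<in>S. trace (f i ** B))"
  for B :: "complex^'d::finite^'d"
  unfolding trace_def matrix_matrix_mult_def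
  by (simp add: sum_distrib_right sum.swap[of _ _ S])

lemma trace_sum: "trace (sum f S) = (\<Sum>i\<in>S. trace (f i))"
  for f :: "'i \<Rightarrow> complex^'d::finite^'d"
  using trace_sum_mult[of f S "mat 1"] by simp

lemma trace_scaleR: "trace (c *\<^sub>R A) = c *\<^sub>R trace A" for A :: "complex^'d::finite^'d"
  using trace_scaleR_mult[of c A "mat 1"] by simp

lemma trace_matrix_unit: "trace (matrix_unit i i) = 1"
  using trace_matrix_unit_mult[of "mat 1" i i] by simp (simp add: mat_def)

text \<open>Taking matrix units for \<open>X\<close> reads off every entry, so the trace pairing is
  nondegenerate and at most one matrix fits the description behind \<open>dual_map\<close>.\<close>

lemma dual_map_eqI:
  assumes "\<And>X. trace (B ** X) = trace (A ** \<Lambda> X)"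
  shows "dual_map \<Lambda> A = B"
  unfolding dual_map_def
proof (rule the_equality)
  fix C assume "\<forall>X. trace (C ** X) = trace (A ** \<Lambda> X)"
  then have "C $ i $ j = B $ i $ j" for i j
    using assms by (metis trace_matrix_unit_mult)
  then show "C = B" by (simp add: vec_eq_iff)
qed (use assms in simp)

lemma dual_map_scaleR:
  assumes "Vector_Spaces.linear matrix_scale matrix_scale \<Lambda>"
  shows "dual_map \<Lambda> (c *\<^sub>R A) = c *\<^sub>R dual_map \<Lambda> A"
  by (rule dual_map_eqI) (simp add: trace_scaleR_mult dual_map_trace[OF assms])

lemma dual_map_sum:
  assumes "Vector_Spaces.linear matrix_scale matrix_scale \<Lambda>"
  shows "dual_map \<Lambda> (\<Sum>i\<in>S. f i) = (\<Sum>i\<in>S. dual_map \<Lambda> (f i))"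
  by (rule dual_map_eqI) (simp add: trace_sum_mult dual_map_trace[OF assms])

text \<open>Since Tr[\<open>dual_map \<Lambda> (mat 1)\<close> X] = Tr[\<open>\<Lambda> X\<close>],
  a condition on the dual becomes one on traces, the form needed to compare with trace
  preservation.\<close>

lemma dual_map_mat1_eq_scaleR:
  assumes "Vector_Spaces.linear matrix_scale matrix_scale \<Lambda>"
  shows "dual_map \<Lambda> (mat 1) = c *\<^sub>R mat 1 \<longleftrightarrow> (\<forall>X. trace (\<Lambda> X) = c *\<^sub>R trace X)"
proof
  assume "dual_map \<Lambda> (mat 1) = c *\<^sub>R mat 1"
  then show "\<forall>X. trace (\<Lambda> X) = c *\<^sub>R trace X"
    using dual_map_trace[OF assms, of "mat 1"] by (simp add: trace_scaleR_mult)
qed (auto intro!: dual_map_eqI simp: trace_scaleR_mult)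

section \<open>Sesquilinear forms and positivity\<close>

lemma sesq_form_sum: "sesq_form u (sum f S) v = (\<Sum>i\<in>S. sesq_form u (f i) v)"
proof -
  have "sesq_form u (sum f S) v
      = (\<Sum>p\<in>UNIV. \<Sum>q\<in>UNIV. \<Sum>i\<in>S. cnj (u $ p) * f i $ p $ q * v $ q)"
    by (simp add: sesq_form_def sum_distrib_left sum_distrib_right)
  also have "\<dots> = (\<Sum>i\<in>S. sesq_form u (f i) v)"
    by (simp add: sesq_form_def sum.swap[of _ S])
  finally show ?thesis .
qed

lemma sesq_form_scaleR: "sesq_form u (c *\<^sub>R A) v = c *\<^sub>R sesq_form u A v"
  by (simp add: sesq_form_def scaleR_sum_right)

lemma sesq_form_axis: "sesq_form (axis p c) A (axis q e) = cnj c * A $ p $ q * e"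
proof -
  have "sesq_form (axis p c) A (axis q e)
      = (\<Sum>p'\<in>UNIV. \<Sum>q'\<in>UNIV. if q' = q then (if p' = p then cnj c * A $ p $ q * e else 0) else 0)"
    unfolding sesq_form_def by (intro sum.cong refl) (auto simp: axis_def)
  then show ?thesis by simp
qed

lemma sesq_form_matrix_unit: "sesq_form u (matrix_unit i j) v = cnj (u $ i) * v $ j"
proof -
  have "sesq_form u (matrix_unit i j) v
      = (\<Sum>p\<in>UNIV. \<Sum>q\<in>UNIV. if q = j then (if p = i then cnj (u $ i) * v $ j else 0) else 0)"
    unfolding sesq_form_def matrix_unit_component by (intro sum.cong refl) auto
  then show ?thesis by simp
qed

lemma psd_scaleR_mat1: "0 \<le> c \<Longrightarrow> psd (c *\<^sub>R mat 1)"
proof -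
  assume "0 \<le> c"
  have "sesq_form v (c *\<^sub>R mat 1) v = of_real (c * (\<Sum>p\<in>UNIV. (cmod (v $ p))\<^sup>2))" for v :: "complex^'d"
  proof -
    have "sesq_form v (mat 1) v
        = (\<Sum>p\<in>UNIV. \<Sum>q\<in>UNIV. if q = p then of_real ((cmod (v $ p))\<^sup>2) else 0)"
      unfolding sesq_form_def
      by (intro sum.cong refl) (auto simp: mat_def mult.commute simp flip: complex_norm_square)
    then show ?thesis by (simp add: sesq_form_scaleR) (simp add: scaleR_conv_of_real)
  qed
  with \<open>0 \<le> c\<close> show ?thesis
    unfolding psd_def by (metis nonneg_Reals_of_real_iff mult_nonneg_nonneg sum_nonneg zero_le_power2)
qed

lemma scaleR_nonneg_Reals: "0 \<le> c \<Longrightarrow> z \<in> \<real>\<^sub>\<ge>\<^sub>0 \<Longrightarrow> c *\<^sub>R z \<in> \<real>\<^sub>\<ge>\<^sub>0" for z :: complex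
  by (simp add: complex_nonneg_Reals_iff)

lemma sum_nonneg_Reals: "(\<And>i. i \<in> S \<Longrightarrow> f i \<in> \<real>\<^sub>\<ge>\<^sub>0) \<Longrightarrow> sum f S \<in> \<real>\<^sub>\<ge>\<^sub>0" for f :: "'i \<Rightarrow> complex"
  by (simp add: complex_nonneg_Reals_iff sum_nonneg)

section \<open>Completely positive maps\<close>

lemma completely_positive_linear:
  "completely_positive \<Lambda> \<Longrightarrow> Vector_Spaces.linear matrix_scale matrix_scale \<Lambda>"
  by (simp add: completely_positive_def)

lemma linear_matrix_scale_iff:
  "Vector_Spaces.linear matrix_scale matrix_scale \<Lambda> \<longleftrightarrow>
     (\<forall>A B. \<Lambda> (A + B) = \<Lambda> A + \<Lambda> B) \<and> (\<forall>c A. \<Lambda> (matrix_scale c A) = matrix_scale c (\<Lambda> A))"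
  by (simp add: Vector_Spaces.linear_iff vector_space_matrix_scale)

lemma completely_positive_scaleR:
  assumes "completely_positive \<Lambda>" "0 \<le> c"
  shows "completely_positive (\<lambda>X. c *\<^sub>R \<Lambda> X)"
proof -
  have "Vector_Spaces.linear matrix_scale matrix_scale (\<lambda>X. c *\<^sub>R \<Lambda> X)"
    using completely_positive_linear[OF assms(1)] unfolding linear_matrix_scale_iff
    by (simp add: algebra_simps matrix_scale_def vec_eq_iff)
  moreover have "psd_block m (\<lambda>i j. c *\<^sub>R \<Lambda> (A i j))" if "psd_block m A" for m A
    using assms that unfolding completely_positive_def psd_block_def
    by (simp add: sesq_form_scaleR scaleR_nonneg_Reals flip: scaleR_sum_right)
  ultimately show ?thesis by (simp add: completely_positive_def)
qed

lemma completely_positive_sum: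
  assumes "\<And>x. x \<in> S \<Longrightarrow> completely_positive (\<Lambda> x)"
  shows "completely_positive (\<lambda>X. \<Sum>x\<in>S. \<Lambda> x X)"
proof -
  have "\<And>x. x \<in> S \<Longrightarrow> Vector_Spaces.linear matrix_scale matrix_scale (\<Lambda> x)"
    using assms completely_positive_linear by blast
  then have "Vector_Spaces.linear matrix_scale matrix_scale (\<lambda>X. \<Sum>x\<in>S. \<Lambda> x X)"
    unfolding linear_matrix_scale_iff
    by (simp add: sum.distrib matrix_scale_def vec_eq_iff sum_distrib_left)
  moreover have "psd_block m (\<lambda>i j. \<Sum>x\<in>S. \<Lambda> x (A i j))" if A: "psd_block m A" for m A
    unfolding psd_block_def
  proof
    fix v
    have "psd_block m (\<lambda>i j. \<Lambda> x (A i j))" if "x \<in> S" for x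
      using assms[OF that] A by (simp add: completely_positive_def)
    then have pos: "(\<Sum>i<m. \<Sum>j<m. sesq_form (v i) (\<Lambda> x (A i j)) (v j)) \<in> \<real>\<^sub>\<ge>\<^sub>0" if "x \<in> S" for x
      using that by (simp add: psd_block_def)
    have "(\<Sum>i<m. \<Sum>j<m. sesq_form (v i) (\<Sum>x\<in>S. \<Lambda> x (A i j)) (v j))
        = (\<Sum>x\<in>S. \<Sum>i<m. \<Sum>j<m. sesq_form (v i) (\<Lambda> x (A i j)) (v j))"
      by (simp add: sesq_form_sum sum.swap[of _ S])
    also have "\<dots> \<in> \<real>\<^sub>\<ge>\<^sub>0"
      by (intro sum_nonneg_Reals pos)
    finally show "(\<Sum>i<m. \<Sum>j<m. sesq_form (v i) (\<Sum>x\<in>S. \<Lambda> x (A i j)) (v j)) \<in> \<real>\<^sub>\<ge>\<^sub>0" .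
  qed
  ultimately show ?thesis by (simp add: completely_positive_def)
qed

text \<open>This is complete positivity with a two-dimensional auxiliary system, applied to the
  array of matrix units on \<open>i\<close> and \<open>j\<close>. The free scalar \<open>s\<close>
  later isolates off-diagonal entries.\<close>

lemma completely_positive_matrix_unit_form:
  assumes "completely_positive \<Lambda>"
  shows "cnj s * \<Lambda> (matrix_unit i i) $ p $ p * s + cnj s * \<Lambda> (matrix_unit i j) $ p $ q
    + (\<Lambda> (matrix_unit j i) $ q $ p * s + \<Lambda> (matrix_unit j j) $ q $ q) \<in> \<real>\<^sub>\<ge>\<^sub>0"
proof -
  define e where "e t = (if t = (0::nat) then i else j)" for t
  have "psd_block 2 (\<lambda>a b. matrix_unit (e a) (e b))"
    unfolding psd_block_def
  proof
    fix v :: "nat \<Rightarrow> complex^'a"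
    \<comment> \<open>The array has rank one: its quadratic form at \<open>v\<close> is the squared
      modulus of \<open>w\<close>.\<close>
    define w where "w = v 0 $ i + v 1 $ j"
    have "(\<Sum>a<2. \<Sum>b<2. sesq_form (v a) (matrix_unit (e a) (e b)) (v b)) = cnj w * w"
      by (simp add: numeral_2_eq_2 e_def sesq_form_matrix_unit w_def algebra_simps)
    also have "\<dots> \<in> \<real>\<^sub>\<ge>\<^sub>0"
      by (simp add: complex_nonneg_Reals_iff)
    finally show "(\<Sum>a<2. \<Sum>b<2. sesq_form (v a) (matrix_unit (e a) (e b)) (v b)) \<in> \<real>\<^sub>\<ge>\<^sub>0" .
  qed
  then have "psd_block 2 (\<lambda>a b. \<Lambda> (matrix_unit (e a) (e b)))"
    using assms by (simp add: completely_positive_def)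
  then show ?thesis
    unfolding psd_block_def
    \<comment> \<open>The test vector has the two blocks \<open>axis p s\<close> and
      \<open>axis q 1\<close>, so each of the four blocks contributes a single entry.\<close>
    by (auto dest!: spec[of _ "\<lambda>t. if t = 0 then axis p s else axis q 1"]
        simp: numeral_2_eq_2 e_def sesq_form_axis)
qed

lemma completely_positive_diagonal:
  assumes "completely_positive \<Lambda>"
  shows "\<Lambda> (matrix_unit i i) $ p $ p \<in> \<real>\<^sub>\<ge>\<^sub>0"
  using completely_positive_matrix_unit_form[OF assms, of 0 i p i p] by simp

text \<open>Nonnegative diagonal entries with sum 0 vanish. With a zero diagonal, positivity of the
  2 by 2 form for all phases \<open>s\<close> leaves no room for off-diagonal entries. This covers
  outcomes of an instrument with weight 0, which cannot be normalized.\<close>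

lemma completely_positive_eq_0:
  assumes cp: "completely_positive \<Lambda>" and tr: "\<And>X. trace (\<Lambda> X) = 0"
  shows "\<Lambda> X = 0"
proof -
  interpret L: Vector_Spaces.linear matrix_scale matrix_scale \<Lambda>
    using cp by (rule completely_positive_linear)
  have diag: "\<Lambda> (matrix_unit i i) $ p $ p = 0" for i p
  proof -
    have *: "Re (\<Lambda> (matrix_unit i i) $ p $ p) \<ge> 0 \<and> Im (\<Lambda> (matrix_unit i i) $ p $ p) = 0" for p
      using completely_positive_diagonal[OF cp] by (simp add: complex_nonneg_Reals_iff)
    have "(\<Sum>p\<in>UNIV. Re (\<Lambda> (matrix_unit i i) $ p $ p)) = 0"
      using arg_cong[OF tr[of "matrix_unit i i"], of Re] by (simp add: trace_def)
    then have "Re (\<Lambda> (matrix_unit i i) $ p $ p) = 0"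
      using * by (simp add: sum_nonneg_eq_0_iff)
    with * show ?thesis by (simp add: complex_eq_iff)
  qed
  have "\<Lambda> (matrix_unit i j) $ p $ q = 0" for i j p q
  proof -
    have "cnj s * \<Lambda> (matrix_unit i j) $ p $ q + \<Lambda> (matrix_unit j i) $ q $ p * s \<in> \<real>\<^sub>\<ge>\<^sub>0" for s
      using completely_positive_matrix_unit_form[OF cp, of s i p j q] by (simp add: diag)
    \<comment> \<open>Write z and w for the two entries. Opposite values of \<open>s\<close> give
      opposite nonnegative numbers, hence 0. Then \<open>s = 1\<close> gives z + w = 0 and
      \<open>s = \<i>\<close> gives z = w.\<close>
    from this[of 1] this[of "-1"] this[of \<i>] this[of "-\<i>"] show ?thesis
      by (simp add: complex_nonneg_Reals_iff complex_eq_iff)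
  qed
  then have "\<Lambda> (matrix_unit i j) = 0" for i j by (simp add: vec_eq_iff)
  then show ?thesis
    by (subst matrix_unit_expansion[of X]) (simp add: L.sum L.scale)
qed

section \<open>Instruments, and the replacement of \<open>\<Lambda>\<close> for one fixed
  \<open>y\<close>\<close>

lemma instrument_linear:
  "instrument \<Lambda> \<Longrightarrow> Vector_Spaces.linear matrix_scale matrix_scale (\<Lambda> x)"
  by (simp add: instrument_def completely_positive_linear)

lemma instrument_trace: "instrument \<Lambda> \<Longrightarrow> (\<Sum>x\<in>UNIV. trace (\<Lambda> x X)) = trace X"
  by (simp add: instrument_def quantum_channel_def trace_preserving_def flip: trace_sum)

lemma dual_map_mat1_component:
  assumes "Vector_Spaces.linear matrix_scale matrix_scale \<Lambda>"
  shows "dual_map \<Lambda> (mat 1) $ i $ i = trace (\<Lambda> (matrix_unit i i))"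
  using dual_map_trace[OF assms, of "mat 1" "matrix_unit i i"] by (simp add: trace_matrix_unit_mult)

text \<open>
  \<open>\<nu> a x b\<close> is the conditional distribution of one fixed \<open>y\<close>. The hypothesis \<open>triv\<close> says that the
  output is trivial on the multimeters which answer \<open>f x\<close> on setting \<open>x\<close> with certainty.
\<close>

lemma ex_uniform_realization:
  fixes \<Lambda> :: "'g::finite \<Rightarrow> complex^'n::finite^'n \<Rightarrow> complex^'d::finite^'d"
    and \<nu> :: "'k::finite \<Rightarrow> 'g \<Rightarrow> 'l \<Rightarrow> real"
  assumes inst: "instrument \<Lambda>"
    and triv: "\<And>f b. \<exists>c. (\<Sum>x\<in>UNIV. \<nu> (f x) x b *\<^sub>R dual_map (\<Lambda> x) (mat 1)) = c *\<^sub>R mat 1"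
  shows "\<exists>\<Lambda>' \<pi> \<Phi>. instrument \<Lambda>' \<and> prob_dist \<pi> \<and> (\<forall>x. quantum_channel (\<Phi> x)) \<and>
    (\<forall>x X. \<Lambda>' x X = \<pi> x *\<^sub>R \<Phi> x X) \<and>
    (\<forall>M :: 'g \<Rightarrow> 'k \<Rightarrow> complex^'d^'d. \<forall>b. multimeter M \<longrightarrow>
       (\<Sum>x\<in>UNIV. \<Sum>a\<in>UNIV. \<nu> a x b *\<^sub>R dual_map (\<Lambda>' x) (M x a)) =
       (\<Sum>x\<in>UNIV. \<Sum>a\<in>UNIV. \<nu> a x b *\<^sub>R dual_map (\<Lambda> x) (M x a)))"
proof -
  note lin = instrument_linear[OF inst]
  have cp: "completely_positive (\<Lambda> x)" for x using inst by (simp add: instrument_def)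
  define E where "E x = dual_map (\<Lambda> x) (mat 1)" for x
  \<comment> \<open>An arbitrary index: any diagonal entry serves, as long as it is the same for all
    \<open>x\<close>.\<close>
  define i :: 'n where "i = undefined"
  define \<pi> where "\<pi> x = Re (E x $ i $ i)" for x
  define good where "good x \<longleftrightarrow> E x = \<pi> x *\<^sub>R mat 1" for x
  define T where "T X = (\<Sum>x\<in>UNIV. \<Lambda> x X)" for X
  \<comment> \<open>A good \<open>x\<close> of positive weight keeps its own map, normalized to a
    channel. Every other \<open>x\<close> gets the total channel \<open>T\<close>; if such an
    \<open>x\<close> is good, its weight is 0 and \<open>\<Lambda> x\<close> will turn out to
    vanish.\<close>
  define \<Phi> where "\<Phi> x = (if good x \<and> \<pi> x \<noteq> 0 then (\<lambda>X. (1 / \<pi> x) *\<^sub>R \<Lambda> x X) else T)" for x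
  define \<Lambda>' where "\<Lambda>' x X = \<pi> x *\<^sub>R \<Phi> x X" for x X
  have E_component: "E x $ i $ i = trace (\<Lambda> x (matrix_unit i i))" for x
    unfolding E_def by (rule dual_map_mat1_component[OF lin])
  have \<pi>_nonneg: "0 \<le> \<pi> x" for x
    using completely_positive_diagonal[OF cp]
    unfolding \<pi>_def E_component by (simp add: trace_def complex_nonneg_Reals_iff sum_nonneg)
  \<comment> \<open>Normalization of \<open>\<pi>\<close> is trace preservation of the whole
    instrument at a matrix unit of trace 1.\<close>
  have "(\<Sum>x\<in>UNIV. \<pi> x) = Re (\<Sum>x\<in>UNIV. trace (\<Lambda> x (matrix_unit i i)))"
    by (simp add: \<pi>_def E_component)
  also have "\<dots> = 1"
    by (simp add: instrument_trace[OF inst] trace_matrix_unit)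
  finally have \<pi>: "prob_dist \<pi>" using \<pi>_nonneg by (simp add: prob_dist_def)
  \<comment> \<open>If \<open>E x\<close> is any multiple of the identity, its entry at
    \<open>(i, i)\<close> forces the factor to be \<open>\<pi> x\<close>.\<close>
  have multiple_good: "good x" if "c \<noteq> 0" "c *\<^sub>R E x = e *\<^sub>R mat 1" for x c e
  proof -
    have E: "E x = (e / c) *\<^sub>R mat 1"
      using that by (metis scaleR_one divide_inverse mult.commute left_inverse scaleR_scaleR)
    then have "\<pi> x = e / c" by (simp add: \<pi>_def mat_def)
    with E show ?thesis by (simp add: good_def)
  qed
  have indep: "\<nu> a x b = \<nu> a' x b" if "\<not> good x" for a a' x b
  proof (rule ccontr)
    assume "\<nu> a x b \<noteq> \<nu> a' x b"
    \<comment> \<open>Compare the answer \<open>a\<close> on all settings with the same answers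
      changed to \<open>a'\<close> at \<open>x\<close> only: in the difference just the term of
      \<open>x\<close> survives.\<close>
    obtain c where c: "(\<Sum>z\<in>UNIV. \<nu> a z b *\<^sub>R E z) = c *\<^sub>R mat 1"
      using triv[of "\<lambda>_. a" b] unfolding E_def by blast
    obtain c' where c': "(\<Sum>z\<in>UNIV. \<nu> (if z = x then a' else a) z b *\<^sub>R E z) = c' *\<^sub>R mat 1"
      using triv[of "\<lambda>z. if z = x then a' else a" b] unfolding E_def by blast
    have "(c - c') *\<^sub>R mat 1
        = (\<Sum>z\<in>UNIV. \<nu> a z b *\<^sub>R E z - \<nu> (if z = x then a' else a) z b *\<^sub>R E z)"
      by (simp add: sum_subtractf c c' scaleR_diff_left)
    also have "\<dots> = (\<Sum>z\<in>UNIV. if z = x then (\<nu> a x b - \<nu> a' x b) *\<^sub>R E x else 0)"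
      by (intro sum.cong refl) (simp add: scaleR_diff_left)
    also have "\<dots> = (\<nu> a x b - \<nu> a' x b) *\<^sub>R E x" by simp
    finally have "(\<nu> a x b - \<nu> a' x b) *\<^sub>R E x = (c - c') *\<^sub>R mat 1" ..
    with \<open>\<nu> a x b \<noteq> \<nu> a' x b\<close> that show False
      using multiple_good[of "\<nu> a x b - \<nu> a' x b" x "c - c'"] by simp
  qed
  have T: "quantum_channel T" using inst by (simp add: instrument_def T_def[abs_def])
  have channel: "quantum_channel (\<Phi> x)" for x
  proof (cases "good x \<and> \<pi> x \<noteq> 0")
    case True
    then have "trace (\<Lambda> x X) = \<pi> x *\<^sub>R trace X" for X
      using dual_map_mat1_eq_scaleR[OF lin] by (simp add: good_def E_def)
    with True \<pi>_nonneg show ?thesis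
      by (simp add: \<Phi>_def quantum_channel_def trace_preserving_def completely_positive_scaleR cp
          trace_scaleR)
  qed (auto simp: \<Phi>_def T)
  have cp': "completely_positive (\<Lambda>' x)" for x
    unfolding \<Lambda>'_def[abs_def] using channel \<pi>_nonneg
    by (simp add: quantum_channel_def completely_positive_scaleR)
  have tr': "trace (\<Lambda>' x X) = \<pi> x *\<^sub>R trace X" for x X
    using channel by (simp add: \<Lambda>'_def trace_scaleR quantum_channel_def trace_preserving_def)
  have "instrument \<Lambda>'"
    using cp' \<pi>
    by (simp add: instrument_def quantum_channel_def completely_positive_sum trace_preserving_def
        trace_sum tr' prob_dist_def flip: scaleR_sum_left)
  moreover have E': "dual_map (\<Lambda>' x) (mat 1) = \<pi> x *\<^sub>R mat 1" for x
    using dual_map_mat1_eq_scaleR[OF completely_positive_linear[OF cp']] tr' by blast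
  have good_eq: "\<Lambda>' x = \<Lambda> x" if "good x" for x
  proof (cases "\<pi> x = 0")
    case True
    with that have "trace (\<Lambda> x X) = 0" for X
      using dual_map_mat1_eq_scaleR[OF lin, of x 0] by (simp add: good_def E_def)
    then have "\<Lambda> x X = 0" for X by (rule completely_positive_eq_0[OF cp])
    with True show ?thesis by (simp add: \<Lambda>'_def fun_eq_iff)
  qed (use that in \<open>simp add: \<Lambda>'_def \<Phi>_def fun_eq_iff\<close>)
  have "(\<Sum>x\<in>UNIV. \<Sum>a\<in>UNIV. \<nu> a x b *\<^sub>R dual_map (\<Lambda>' x) (M x a)) =
        (\<Sum>x\<in>UNIV. \<Sum>a\<in>UNIV. \<nu> a x b *\<^sub>R dual_map (\<Lambda> x) (M x a))" (is "?L = ?R")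
    if M: "multimeter M" for M b
  proof -
    define a0 :: 'k where "a0 = undefined"
    \<comment> \<open>With weights independent of the outcome, the effects of \<open>M x\<close> add
      up to the identity under the dual. A general \<open>\<Gamma>\<close> allows use for both
      \<open>\<Lambda> x\<close> and \<open>\<Lambda>' x\<close>.\<close>
    have bad: "(\<Sum>a\<in>UNIV. \<nu> a x b *\<^sub>R dual_map \<Gamma> (M x a)) = \<nu> a0 x b *\<^sub>R dual_map \<Gamma> (mat 1)"
      if "\<not> good x" "Vector_Spaces.linear matrix_scale matrix_scale \<Gamma>"
      for x and \<Gamma> :: "complex^'n^'n \<Rightarrow> complex^'d^'d"
    proof -
      have "(\<Sum>a\<in>UNIV. \<nu> a x b *\<^sub>R dual_map \<Gamma> (M x a)) = \<nu> a0 x b *\<^sub>R (\<Sum>a\<in>UNIV. dual_map \<Gamma> (M x a))"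
        unfolding scaleR_sum_right
        by (intro sum.cong refl arg_cong2[where f = scaleR] indep that(1))
      also have "\<dots> = \<nu> a0 x b *\<^sub>R dual_map \<Gamma> (mat 1)"
        using M that(2) by (simp add: multimeter_def povm_def flip: dual_map_sum)
      finally show ?thesis .
    qed
    \<comment> \<open>The sum may run over all \<open>x\<close>: for good \<open>x\<close> both
      sides agree, and the summand on the right is 0 because \<open>E x\<close> equals
      \<open>\<pi> x *\<^sub>R mat 1\<close>.\<close>
    have "?R - ?L = (\<Sum>x\<in>UNIV. \<nu> a0 x b *\<^sub>R E x - (\<nu> a0 x b * \<pi> x) *\<^sub>R mat 1)"
    proof (subst sum_subtractf[symmetric], intro sum.cong refl)
      fix x
      show "(\<Sum>a\<in>UNIV. \<nu> a x b *\<^sub>R dual_map (\<Lambda> x) (M x a)) - (\<Sum>a\<in>UNIV. \<nu> a x b *\<^sub>R dual_map (\<Lambda>' x) (M x a))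
        = \<nu> a0 x b *\<^sub>R E x - (\<nu> a0 x b * \<pi> x) *\<^sub>R mat 1"
      proof (cases "good x")
        case True
        then show ?thesis by (simp add: good_eq) (simp add: good_def)
      next
        case False
        then show ?thesis
          by (simp add: bad lin completely_positive_linear[OF cp'] E' flip: E_def)
      qed
    qed
    also have "\<dots> = 0"
    proof -
      obtain c where c: "(\<Sum>x\<in>UNIV. \<nu> a0 x b *\<^sub>R E x) = c *\<^sub>R mat 1"
        using triv[of "\<lambda>_. a0" b] unfolding E_def by blast
      \<comment> \<open>The entry at \<open>(i, i)\<close> identifies \<open>c\<close> with the
        average of the weights under \<open>\<pi>\<close>, so the two sums cancel.\<close>
      have "Re ((\<Sum>x\<in>UNIV. \<nu> a0 x b *\<^sub>R E x) $ i $ i) = c"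
        unfolding c by (simp add: mat_def)
      then have "(\<Sum>x\<in>UNIV. \<nu> a0 x b * \<pi> x) = c" by (simp add: \<pi>_def)
      with c show ?thesis by (simp add: sum_subtractf flip: scaleR_sum_left)
    qed
    finally show ?thesis by simp
  qed
  ultimately show ?thesis
    using \<pi> channel \<Lambda>'_def by blast
qed

section \<open>Triviality preservation and the equivalence\<close>

lemma deterministic_povm: "povm (\<lambda>a. of_bool (a = c) *\<^sub>R mat 1)"
  by (simp add: povm_def psd_scaleR_mat1 flip: scaleR_sum_left)

text \<open>By linearity the dual maps send multiples of the identity to multiples of the identity,
  and the output effects are sums of these.\<close>

lemma triviality_preserving_if_uniform:
  fixes \<Psi> :: "complex^('k::finite \<times> 'd::finite \<times> 'g::finite)^('k \<times> 'd \<times> 'g) \<Rightarrow>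
               complex^('l::finite \<times> 'n::finite \<times> 'r::finite)^('l \<times> 'n \<times> 'r)"
  assumes real: "ancilla_free_realization \<Psi> \<Lambda> \<nu>"
    and \<pi>: "\<And>y. prob_dist (\<pi> y)"
    and E: "\<And>x y. dual_map (\<Lambda> y x) (mat 1) = \<pi> y x *\<^sub>R mat 1"
  shows "triviality_preserving \<Psi>"
  unfolding triviality_preserving_def
proof (intro allI impI)
  fix M :: "'g \<Rightarrow> 'k \<Rightarrow> complex^'d^'d" and N :: "'r \<Rightarrow> 'l \<Rightarrow> complex^'n^'n" and y
  assume M: "multimeter M" "\<forall>x. trivial_povm (M x)" and N: "multimeter N"
    and eq: "\<Psi> (multimeter_choi M) = multimeter_choi N"
  have lin: "Vector_Spaces.linear matrix_scale matrix_scale (\<Lambda> y x)" for x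
    using real by (simp add: ancilla_free_realization_def instrument_linear)
  have \<nu>: "prob_dist (\<nu> a x y)" for a x
    using real by (simp add: ancilla_free_realization_def)
  obtain p where p: "\<And>x. prob_dist (p x)" and Mp: "\<And>x a. M x a = p x a *\<^sub>R mat 1"
    using M(2) unfolding trivial_povm_def by metis
  \<comment> \<open>The law of \<open>b\<close> when \<open>x\<close> is drawn from
    \<open>\<pi> y\<close>, then \<open>a\<close> from \<open>p x\<close>, then \<open>b\<close>
    from \<open>\<nu> a x y\<close>.\<close>
  define q where "q b = (\<Sum>x\<in>UNIV. \<Sum>a\<in>UNIV. \<nu> a x y b * (p x a * \<pi> y x))" for b
  \<comment> \<open>Injectivity of the Choi matrix identifies \<open>N\<close> with the realized
    multimeter.\<close>
  have "N = (\<lambda>y b. \<Sum>x\<in>UNIV. \<Sum>a\<in>UNIV. \<nu> a x y b *\<^sub>R dual_map (\<Lambda> y x) (M x a))"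
    using real M(1) eq by (simp add: ancilla_free_realization_def multimeter_choi_inject)
  then have "N y b = q b *\<^sub>R mat 1" for b
    by (simp add: Mp dual_map_scaleR[OF lin] E q_def scaleR_sum_left)
  moreover have "prob_dist q"
    unfolding prob_dist_def
  proof
    show "\<forall>b. 0 \<le> q b"
      using \<nu> p \<pi> by (simp add: q_def prob_dist_def sum_nonneg)
    have "(\<Sum>b\<in>UNIV. q b) = (\<Sum>x\<in>UNIV. \<Sum>a\<in>UNIV. (\<Sum>b\<in>UNIV. \<nu> a x y b) * (p x a * \<pi> y x))"
      by (simp add: q_def sum.swap[of _ _ "UNIV :: 'l set"] sum_distrib_right)
    also have "\<dots> = 1"
      using \<nu> p \<pi> by (simp add: prob_dist_def flip: sum_distrib_right)
    finally show "(\<Sum>b\<in>UNIV. q b) = 1" .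
  qed
  ultimately show "trivial_povm (N y)"
    using N by (auto simp: trivial_povm_def multimeter_def)
qed

text \<open>Each \<open>y\<close> is treated separately with the same \<open>\<nu>\<close>, since
  only the instruments change. The superchannel property supplies the output multimeter to which
  triviality preservation applies.\<close>

lemma uniform_realization_if_triviality_preserving:
  fixes \<Psi> :: "complex^('k::finite \<times> 'd::finite \<times> 'g::finite)^('k \<times> 'd \<times> 'g) \<Rightarrow>
               complex^('l::finite \<times> 'n::finite \<times> 'r::finite)^('l \<times> 'n \<times> 'r)"
  assumes super: "multimeter_superchannel \<Psi>"
    and real: "ancilla_free_realization \<Psi> \<Lambda> \<nu>"
    and triv: "triviality_preserving \<Psi>"
  shows "\<exists>\<Lambda>' \<pi> \<Phi>. ancilla_free_realization \<Psi> \<Lambda>' \<nu> \<and> (\<forall>y. prob_dist (\<pi> y)) \<and>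
    (\<forall>x y. quantum_channel (\<Phi> x y)) \<and> (\<forall>x y X. \<Lambda>' y x X = \<pi> y x *\<^sub>R \<Phi> x y X)"
proof -
  have inst: "instrument (\<Lambda> y)" for y
    using real by (simp add: ancilla_free_realization_def)
  have det: "\<exists>c. (\<Sum>x\<in>UNIV. \<nu> (f x) x y b *\<^sub>R dual_map (\<Lambda> y x) (mat 1)) = c *\<^sub>R mat 1" for f y b
  proof -
    define M :: "'g \<Rightarrow> 'k \<Rightarrow> complex^'d^'d" where "M x a = of_bool (a = f x) *\<^sub>R mat 1" for x a
    have povm: "povm (M x)" for x
      using deterministic_povm[of "f x"] by (simp add: M_def[abs_def])
    then have M: "multimeter M" by (simp add: multimeter_def)
    have "prob_dist (\<lambda>a. of_bool (a = f x))" for x by (simp add: prob_dist_def)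
    with povm have M_triv: "trivial_povm (M x)" for x
      unfolding trivial_povm_def M_def by blast
    obtain N :: "'r \<Rightarrow> 'l \<Rightarrow> complex^'n^'n"
      where N: "multimeter N" "\<Psi> (multimeter_choi M) = multimeter_choi N"
      using super M unfolding multimeter_superchannel_def by blast
    then have "trivial_povm (N y)"
      using triv M M_triv unfolding triviality_preserving_def by blast
    then obtain c where c: "N y b = c *\<^sub>R mat 1" unfolding trivial_povm_def by blast
    have "N = (\<lambda>y b. \<Sum>x\<in>UNIV. \<Sum>a\<in>UNIV. \<nu> a x y b *\<^sub>R dual_map (\<Lambda> y x) (M x a))"
      using real M N by (simp add: ancilla_free_realization_def multimeter_choi_inject)
    then have "N y b = (\<Sum>x\<in>UNIV. \<Sum>a\<in>UNIV. \<nu> a x y b *\<^sub>R dual_map (\<Lambda> y x) (M x a))" by simp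
    \<comment> \<open>Determinism of \<open>M\<close> leaves only the outcome \<open>f x\<close> for
      each setting.\<close>
    also have "\<dots> = (\<Sum>x\<in>UNIV. \<Sum>a\<in>UNIV.
        if a = f x then \<nu> (f x) x y b *\<^sub>R dual_map (\<Lambda> y x) (mat 1) else 0)"
      by (intro sum.cong refl) (simp add: M_def dual_map_scaleR[OF instrument_linear[OF inst]] del: scaleR_zero_left)
    also have "\<dots> = (\<Sum>x\<in>UNIV. \<nu> (f x) x y b *\<^sub>R dual_map (\<Lambda> y x) (mat 1))" by simp
    finally show ?thesis using c by metis
  qed
  \<comment> \<open>\<open>P\<close> collects what is wanted for one \<open>y\<close>, so that
    choice over \<open>y\<close> yields whole families at once.\<close>
  define P where "P y \<Lambda>' \<pi> \<Phi> \<longleftrightarrow>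
    instrument \<Lambda>' \<and> prob_dist \<pi> \<and> (\<forall>x. quantum_channel (\<Phi> x)) \<and>
    (\<forall>x X. \<Lambda>' x X = \<pi> x *\<^sub>R \<Phi> x X) \<and>
    (\<forall>M :: 'g \<Rightarrow> 'k \<Rightarrow> complex^'d^'d. \<forall>b. multimeter M \<longrightarrow>
       (\<Sum>x\<in>UNIV. \<Sum>a\<in>UNIV. \<nu> a x y b *\<^sub>R dual_map (\<Lambda>' x) (M x a)) =
       (\<Sum>x\<in>UNIV. \<Sum>a\<in>UNIV. \<nu> a x y b *\<^sub>R dual_map (\<Lambda> y x) (M x a)))"
    for y \<Lambda>' \<pi> and \<Phi> :: "'g \<Rightarrow> complex^'n^'n \<Rightarrow> complex^'d^'d"
  have "\<exists>\<Lambda>' \<pi> \<Phi>. P y \<Lambda>' \<pi> \<Phi>" for y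
    unfolding P_def by (rule ex_uniform_realization[OF inst det])
  then obtain \<Lambda>' \<pi> \<Phi> where *: "\<And>y. P y (\<Lambda>' y) (\<pi> y) (\<Phi> y)" by metis
  have "ancilla_free_realization \<Psi> \<Lambda>' \<nu>"
    using real * by (simp add: ancilla_free_realization_def P_def)
  with * show ?thesis
    unfolding P_def by (intro exI[of _ \<Lambda>'] exI[of _ \<pi>] exI[of _ "\<lambda>x y. \<Phi> y x"]) blast
qed

text \<open>Links the description by channels to the one by duals: a channel preserves the trace, so
  \<open>\<Lambda>\<close> multiplies it by \<open>c\<close>.\<close>

lemma dual_map_mat1_scaleR_channel:
  assumes "quantum_channel \<Phi>" "\<And>X. \<Lambda> X = c *\<^sub>R \<Phi> X"
  shows "dual_map \<Lambda> (mat 1) = c *\<^sub>R mat 1"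
  by (rule dual_map_eqI)
    (use assms in \<open>simp add: trace_scaleR_mult trace_scaleR quantum_channel_def trace_preserving_def\<close>)

theorem theorem6p3:
  fixes \<Psi> :: "complex^('k::finite \<times> 'd::finite \<times> 'g::finite)^('k \<times> 'd \<times> 'g) \<Rightarrow>
               complex^('l::finite \<times> 'n::finite \<times> 'r::finite)^('l \<times> 'n \<times> 'r)"
  assumes superchannel: "multimeter_superchannel \<Psi>"
    and ancilla_free: "\<exists>\<Lambda> \<nu>. ancilla_free_realization \<Psi> \<Lambda> \<nu>"
  shows "(triviality_preserving \<Psi> \<longleftrightarrow>
            (\<exists>\<Lambda> \<nu>. ancilla_free_realization \<Psi> \<Lambda> \<nu> \<and>
               (\<exists>\<pi> :: 'r \<Rightarrow> 'g \<Rightarrow> real. (\<forall>y. prob_dist (\<pi> y)) \<and>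
                  (\<forall>x y. dual_map (\<Lambda> y x) (mat 1) = \<pi> y x *\<^sub>R mat 1)))) \<and>
         (triviality_preserving \<Psi> \<longleftrightarrow>
            (\<exists>\<Lambda> \<nu>. ancilla_free_realization \<Psi> \<Lambda> \<nu> \<and>
               (\<exists>(\<pi> :: 'r \<Rightarrow> 'g \<Rightarrow> real)
                 (\<Phi> :: 'g \<Rightarrow> 'r \<Rightarrow> complex^'n^'n \<Rightarrow> complex^'d^'d).
                  (\<forall>y. prob_dist (\<pi> y)) \<and>
                  (\<forall>x y. quantum_channel (\<Phi> x y)) \<and>
                  (\<forall>x y X. \<Lambda> y x X = \<pi> y x *\<^sub>R \<Phi> x y X))))"
proof -
  obtain \<Lambda> \<nu> where real: "ancilla_free_realization \<Psi> \<Lambda> \<nu>" using ancilla_free by blast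
  let ?A = "triviality_preserving \<Psi>"
  let ?B = "\<exists>\<Lambda> \<nu>. ancilla_free_realization \<Psi> \<Lambda> \<nu> \<and>
      (\<exists>\<pi> :: 'r \<Rightarrow> 'g \<Rightarrow> real. (\<forall>y. prob_dist (\<pi> y)) \<and>
         (\<forall>x y. dual_map (\<Lambda> y x) (mat 1) = \<pi> y x *\<^sub>R mat 1))"
  let ?C = "\<exists>\<Lambda> \<nu>. ancilla_free_realization \<Psi> \<Lambda> \<nu> \<and>
      (\<exists>(\<pi> :: 'r \<Rightarrow> 'g \<Rightarrow> real)
        (\<Phi> :: 'g \<Rightarrow> 'r \<Rightarrow> complex^'n^'n \<Rightarrow> complex^'d^'d).
         (\<forall>y. prob_dist (\<pi> y)) \<and> (\<forall>x y. quantum_channel (\<Phi> x y)) \<and>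
         (\<forall>x y X. \<Lambda> y x X = \<pi> y x *\<^sub>R \<Phi> x y X))"
  \<comment> \<open>The three assertions are closed into a cycle; the construction yields the
    channel form directly.\<close>
  have "?A \<Longrightarrow> ?C"
    using uniform_realization_if_triviality_preserving[OF superchannel real] by blast
  moreover have "?C \<Longrightarrow> ?B"
    using dual_map_mat1_scaleR_channel by meson
  moreover have "?B \<Longrightarrow> ?A"
    using triviality_preserving_if_uniform by blast
  ultimately show ?thesis by blast
qed

end
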